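(* Let $B=(\beta_n)_{n\in\mathbb Z}$ be a two-way real Cantor base. For all $n\in\mathbb N$, we have \[ d_B(M_{B,n})=d_{n,1}\cdots d_{n,n}\bullet 0^\omega \quad\text{and}\quad \Delta_n=\mathrm{val}_B(0\bullet d_{n,n+1}d_{n,n+2}\cdots). \]
   Context: $\mathbb N=\{0,1,2,\dots\}$. A two-way real Cantor base is a bi-infinite sequence $B=(\beta_n)_{n\in\mathbb Z}$ of real numbers greater than $1$ with $\prod_{n=0}^{\infty}\beta_n=+\infty$ and $\prod_{n=1}^{\infty}\beta_{-n}=+\infty$. For $N\in\mathbb Z$, $S^N(B)=(\beta_{n+N})_{n\in\mathbb Z}$. For a sequence $a=(a_n)_{n\in\mathbb Z}$ over $\mathbb N$ with $a_n=0$ for all $n>N$ ($N\ge 0$), written $a_N\cdots a_0\bullet a_{-1}a_{-2}\cdots$ ($\bullet$ is the radix point; leading zeros may be added or omitted), \[\mathrm{val}_B(a)=\sum_{n=0}^N a_n\beta_{n-1}\cdots\beta_0+\sum_{n=1}^\infty\frac{a_{-n}}{\beta_{-1}\cdots\beta_{-n}}\] whenever the series converges. $B$-expansion $d_B(x)=(a_n)_{n\in\mathbb Z}$ of a real $x\ge0$. If $x\in[0,1)$: $a_n=0$ for $n\ge 0$, $r_{-1}=x$, and for $n\le -1$ iteratively $a_n=\lfloor\beta_n r_n\rfloor$, $r_{n-1}=\beta_n r_n-a_n$. If $x\ge 1$: let $N\ge0$ be minimal with $x<\beta_N\cdots\beta_0$, put $a_n=0$ for $n>N$, $r_N=x/(\beta_N\cdots\beta_0)$,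 and for $n\le N$ iteratively $a_n=\lfloor\beta_n r_n\rfloor$, $r_{n-1}=\beta_n r_n-a_n$. A $B$-integer is a real $x\ge0$ whose $B$-expansion has only zeros after the radix point; $\mathbb N_B$ is the set of $B$-integers (it is unbounded without accumulation points). For $n\in\mathbb N$, $M_{B,n}=\max\{x\in\mathbb N_B:x<\beta_{n-1}\cdots\beta_0\}$ (empty product $=1$) and $\Delta_n=\beta_{n-1}\cdots\beta_0-M_{B,n}$. Quasi-greedy expansion of $1$: the limit $\lim_{x\to1^-}d_B(x)$ (in the product topology) exists and has the form $0\bullet a_{-1}a_{-2}a_{-3}\cdots$; one sets $d_B^*(1)=a_{-1}a_{-2}a_{-3}\cdots$, an infinite word. For $n\in\mathbb N$ one writes $d^*_{S^n(B)}(1)=d_{n,1}d_{n,2}d_{n,3}\cdots$ (the quasi-greedy expansion of $1$ for the base $S^n(B)$). *)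

theory Defs
  imports "HOL-Analysis.Analysis"
begin

type_synonym base = "int \<Rightarrow> real"

definition two_way_cantor_base :: "base \<Rightarrow> bool" where
  "two_way_cantor_base B \<longleftrightarrow>
     (\<forall>n. B n > 1) \<and>
     filterlim (\<lambda>N. \<Prod>n<N. B (int n)) at_top sequentially \<and>
     filterlim (\<lambda>N. \<Prod>n=1..N. B (- int n)) at_top sequentially"

definition shift_base :: "int \<Rightarrow> base \<Rightarrow> base" where
  "shift_base N B = (\<lambda>n. B (n + N))"

definition base_weight :: "base \<Rightarrow> nat \<Rightarrow> real" where
  "base_weight B n = (\<Prod>i<n. B (int i))"

text \<open>
  Digit sequences are functions \<open>int \<Rightarrow> nat\<close>.  Infinite words \<open>w\<^sub>1 w\<^sub>2 w\<^sub>3 \<dots>\<close> are functions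
  \<open>nat \<Rightarrow> nat\<close> read from index 1 on; the value at 0 is never used.  In \<open>radix_word u v\<close> the
  list \<open>u\<close> is written from the most significant digit down and ends just before the radix
  point, and \<open>v\<close> is the infinite word after it.
\<close>

definition radix_word :: "nat list \<Rightarrow> (nat \<Rightarrow> nat) \<Rightarrow> int \<Rightarrow> nat" where
  "radix_word u v = (\<lambda>i. if i < 0 then v (nat (- i))
                         else if nat i < length u then rev u ! nat i
                         else 0)"

text \<open>
  \<open>has_val B a\<close> says that \<open>a\<close> has finitely many nonzero digits at nonnegative positions and
  that the series of its fractional part converges; \<open>val B a\<close> is meaningful only then.
\<close>

definition frac_term :: "base \<Rightarrow> (int \<Rightarrow> nat) \<Rightarrow> nat \<Rightarrow> real" where
  "frac_term B a n = real (a (- int n)) / (\<Prod>i=1..n. B (- int i))"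

definition has_val :: "base \<Rightarrow> (int \<Rightarrow> nat) \<Rightarrow> bool" where
  "has_val B a \<longleftrightarrow>
     (\<exists>N\<ge>0. \<forall>n>N. a n = 0) \<and> summable (\<lambda>n. frac_term B a (Suc n))"

definition val :: "base \<Rightarrow> (int \<Rightarrow> nat) \<Rightarrow> real" where
  "val B a = (\<Sum>n | a (int n) \<noteq> 0. real (a (int n)) * base_weight B n)
             + (\<Sum>n. frac_term B a (Suc n))"

definition exp_start :: "base \<Rightarrow> real \<Rightarrow> int" where
  "exp_start B x = (if x < 1 then -1 else int (LEAST N. x < (\<Prod>i\<le>N. B (int i))))"

text \<open>
  With \<open>N = exp_start B x\<close>, \<open>exp_rest B x k\<close> is the remainder with index \<open>N - k\<close>.
\<close>

primrec exp_rest :: "base \<Rightarrow> real \<Rightarrow> nat \<Rightarrow> real" where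
  "exp_rest B x 0 = (if x < 1 then x else x / (\<Prod>i\<le>nat (exp_start B x). B (int i)))"
| "exp_rest B x (Suc k) =
     B (exp_start B x - int k) * exp_rest B x k
     - of_int \<lfloor>B (exp_start B x - int k) * exp_rest B x k\<rfloor>"

definition expansion :: "base \<Rightarrow> real \<Rightarrow> int \<Rightarrow> nat" where
  "expansion B x = (\<lambda>n. if n > exp_start B x then 0
                        else nat \<lfloor>B n * exp_rest B x (nat (exp_start B x - n))\<rfloor>)"

definition B_integers :: "base \<Rightarrow> real set" where
  "B_integers B = {x. x \<ge> 0 \<and> (\<forall>n<0. expansion B x n = 0)}"

definition M :: "base \<Rightarrow> nat \<Rightarrow> real" where
  "M B n = (GREATEST x. x \<in> B_integers B \<and> x < base_weight B n)"

definition Delta :: "base \<Rightarrow> nat \<Rightarrow> real" where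
  "Delta B n = base_weight B n - M B n"

text \<open>
  The limit is taken in the type \<open>int \<Rightarrow> nat\<close>, whose topology is the product of the discrete
  topologies on \<open>nat\<close>.  This type is not registered as a Hausdorff space in the library, so
  \<open>Lim\<close> is not available and its definition is written out.
\<close>

definition quasi_greedy_one :: "base \<Rightarrow> nat \<Rightarrow> nat" where
  "quasi_greedy_one B =
     (\<lambda>k. (THE l :: int \<Rightarrow> nat. (expansion B \<longlongrightarrow> l) (at_left 1)) (- int k))"

end

theory Submission
  imports Defs
begin

text \<open>
  Only the digits of \<open>B\<close> read downwards from a position matter, so everything takes place in a
  one-sided base \<open>c\<^sub>0, c\<^sub>1, \<dots>\<close>; for the theorem \<open>c\<^sub>k = \<beta>\<^bsub>n-1-k\<^esub>\<close>, and \<open>W = c\<^sub>0 \<cdots> c\<^bsub>n-1\<^esub>\<close>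
  is the weight of position \<open>n\<close>.  For \<open>0 \<le> x < W\<close> the \<open>B\<close>-expansion of \<open>x\<close> is the greedy
  expansion of \<open>x / W\<close> in \<open>c\<close>, up to leading zeros (\<open>expansion_conv_greedy_rem\<close>).

  As \<open>y\<close> tends to 1 from the left, the greedy remainders of \<open>y\<close> tend, each from the left, to the
  sequence \<open>q\<^sub>0 = 1\<close>, \<open>q\<^bsub>k+1\<^esub> = c\<^sub>k q\<^sub>k - (\<lceil>c\<^sub>k q\<^sub>k\<rceil> - 1) \<in> (0, 1]\<close>, and each digit is eventually
  \<open>\<lceil>c\<^sub>k q\<^sub>k\<rceil> - 1\<close> (\<open>greedy_rem_at_left_1\<close>, \<open>greedy_digit_at_left_1\<close>).  These are therefore the digits
  of the quasi-greedy expansion of 1 (\<open>quasi_greedy_one_eq\<close>).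

  Cutting this expansion after \<open>n\<close> digits leaves the number \<open>W - q\<^sub>n\<close>.  Its greedy expansion
  consists of precisely these \<open>n\<close> digits followed by zeros (\<open>greedy_rem_truncation\<close>), and no number
  below \<open>W\<close> whose greedy remainder vanishes after \<open>n\<close> digits exceeds it
  (\<open>greedy_rem_less_quasi_rem\<close>).  Because \<open>\<beta>\<^bsub>-1\<^esub> \<beta>\<^bsub>-2\<^esub> \<cdots>\<close> diverges, zero digits after the radix point
  force that remainder to vanish (\<open>greedy_rem_no_digits\<close>), so \<open>M\<^bsub>B,n\<^esub> = W - q\<^sub>n\<close> (\<open>M_eq\<close>) and
  \<open>\<Delta>\<^sub>n = q\<^sub>n\<close>.  By the same divergence, \<open>q\<^sub>n\<close> is the sum of the series with the remaining
  quasi-greedy digits (\<open>quasi_rem_sums\<close>).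
\<close>

section \<open>Greedy and quasi-greedy remainders for a one-sided base\<close>

text \<open>
  The \<open>k\<close>-th remainder of the greedy algorithm in the one-sided base \<open>c\<close>, started at \<open>y\<close>.  The
  digit produced in step \<open>k\<close> is \<open>\<lfloor>c k * greedy_rem c y k\<rfloor>\<close>.
\<close>

primrec greedy_rem :: "(nat \<Rightarrow> real) \<Rightarrow> real \<Rightarrow> nat \<Rightarrow> real" where
  "greedy_rem c y 0 = y"
| "greedy_rem c y (Suc k) = frac (c k * greedy_rem c y k)"

text \<open>
  The remainders of the quasi-greedy algorithm for 1: the digit is the largest integer strictly
  below \<open>c k * quasi_rem c k\<close>, so that the remainders stay in \<open>(0, 1]\<close>.
\<close>

primrec quasi_rem :: "(nat \<Rightarrow> real) \<Rightarrow> nat \<Rightarrow> real" where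
  "quasi_rem c 0 = 1"
| "quasi_rem c (Suc k) = c k * quasi_rem c k - of_int (\<lceil>c k * quasi_rem c k\<rceil> - 1)"

text \<open>
  The quasi-greedy digits of 1.  They are numbered from 0, whereas words start at index 1.
\<close>

definition quasi_digit :: "(nat \<Rightarrow> real) \<Rightarrow> nat \<Rightarrow> int" where
  "quasi_digit c k = \<lceil>c k * quasi_rem c k\<rceil> - 1"

lemma quasi_rem_Suc: "c k * quasi_rem c k = of_int (quasi_digit c k) + quasi_rem c (Suc k)"
  by (simp add: quasi_digit_def)

lemma quasi_rem_bounds: "0 < quasi_rem c k \<and> quasi_rem c k \<le> 1"
proof (cases k)
  case (Suc j)
  then show ?thesis by simp linarith
qed simp

lemma quasi_digit_nonneg:
  assumes "c k > 0"
  shows "quasi_digit c k \<ge> 0"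
proof -
  have "c k * quasi_rem c k > 0" using assms quasi_rem_bounds by simp
  then show ?thesis by (simp add: quasi_digit_def)
qed

lemma greedy_rem_bounds:
  assumes "0 \<le> y" "y < 1"
  shows "0 \<le> greedy_rem c y k \<and> greedy_rem c y k < 1"
  using assms by (cases k) (simp_all add: frac_lt_1)

lemma greedy_rem_add:
  "greedy_rem c y (a + b) = greedy_rem (\<lambda>j. c (a + j)) (greedy_rem c y a) b"
  by (induction b) simp_all

lemma greedy_rem_zero: "greedy_rem c 0 k = 0"
  by (induction k) simp_all

text \<open>
  Close to \<open>q\<close> on its left, \<open>c * r\<close> lies between \<open>\<lceil>c * q\<rceil> - 1\<close> and \<open>c * q\<close>.  Hence one greedy
  step turns convergence from the left into convergence from the left, and can be iterated.
\<close>

lemma frac_mult_at_left: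
  fixes c q :: real
  assumes "c > 0"
  defines "z \<equiv> \<lceil>c * q\<rceil> - 1"
  shows "eventually (\<lambda>r. \<lfloor>c * r\<rfloor> = z) (at_left q)"
    and "filterlim (\<lambda>r. frac (c * r)) (at_left (c * q - of_int z)) (at_left q)"
proof -
  have z: "of_int z < c * q" "c * q \<le> of_int z + 1" unfolding z_def by linarith+
  show ev: "eventually (\<lambda>r. \<lfloor>c * r\<rfloor> = z) (at_left q)"
    unfolding eventually_at_left_field
  proof (intro exI[of _ "of_int z / c"] conjI allI impI)
    show "of_int z / c < q" using z assms(1) by (simp add: divide_less_eq mult.commute)
    fix r assume r: "of_int z / c < r" "r < q"
    have "of_int z < c * r" using r assms(1) by (simp add: divide_less_eq mult.commute)
    moreover have "c * r < c * q" using r assms(1) by simp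
    ultimately show "\<lfloor>c * r\<rfloor> = z" using z by (intro floor_unique) linarith+
  qed
  have "((\<lambda>r. c * r - of_int z) \<longlongrightarrow> c * q - of_int z) (at_left q)"
    by (intro tendsto_intros)
  moreover have "eventually (\<lambda>r. c * r - of_int z \<in> {..<c * q - of_int z} \<and>
      c * r - of_int z \<noteq> c * q - of_int z) (at_left q)"
    using assms(1) by (auto simp: eventually_at_filter)
  ultimately have "filterlim (\<lambda>r. c * r - of_int z) (at_left (c * q - of_int z)) (at_left q)"
    by (simp add: filterlim_at)
  moreover have "eventually (\<lambda>r. c * r - of_int z = frac (c * r)) (at_left q)"
    using ev by eventually_elim (simp add: frac_def)
  ultimately show "filterlim (\<lambda>r. frac (c * r)) (at_left (c * q - of_int z)) (at_left q)"
    by (rule filterlim_cong[OF refl refl, THEN iffD1, rotated])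
qed

lemma greedy_rem_at_left_1:
  assumes "\<And>k. c k > 0"
  shows "filterlim (\<lambda>y. greedy_rem c y k) (at_left (quasi_rem c k)) (at_left 1)"
proof (induction k)
  case 0
  then show ?case by (simp add: filterlim_ident)
next
  case (Suc k)
  show ?case
    using filterlim_compose[OF frac_mult_at_left(2)[OF assms[of k]] Suc] by simp
qed

lemma greedy_digit_at_left_1:
  assumes "\<And>k. c k > 0"
  shows "eventually (\<lambda>y. \<lfloor>c k * greedy_rem c y k\<rfloor> = quasi_digit c k) (at_left 1)"
  using filterlim_iff[THEN iffD1, OF greedy_rem_at_left_1[of c k, OF assms]]
    frac_mult_at_left(1)[OF assms[of k]]
  by (auto simp: quasi_digit_def)

section \<open>The largest terminating expansion\<close>

lemma prod_drop_first:
  fixes c :: "nat \<Rightarrow> real"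
  assumes "j < n"
  shows "(\<Prod>i=j..<n. c i) = c j * (\<Prod>i=Suc j..<n. c i)"
  using assms by (rule prod.atLeast_Suc_lessThan)

text \<open>
  The left-hand side is what remains of \<open>quasi_rem c j\<close>, suitably scaled, after nonnegative digits
  have been subtracted.
\<close>

lemma quasi_rem_mult_ge:
  assumes "\<And>k. c k > 0" "j \<le> n"
  shows "quasi_rem c n \<le> quasi_rem c j * (\<Prod>i=j..<n. c i)"
  using assms(2)
proof (induction j rule: inc_induct)
  case (step j)
  have "quasi_rem c (Suc j) \<le> c j * quasi_rem c j"
    using quasi_rem_Suc[of c j] quasi_digit_nonneg[of c j, OF assms(1)]
    by (simp del: quasi_rem.simps)
  then have "quasi_rem c (Suc j) * (\<Prod>i=Suc j..<n. c i)
      \<le> (c j * quasi_rem c j) * (\<Prod>i=Suc j..<n. c i)"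
    using assms(1) by (intro mult_right_mono) (simp_all add: prod_nonneg less_imp_le)
  then show ?case using step prod_drop_first[of j n c] by (simp add: algebra_simps)
qed simp

text \<open>
  The number \<open>z\<close> is the value of the first \<open>n\<close> quasi-greedy digits of 1.  Its greedy remainders are
  the quasi-greedy ones, each reduced by the same tail.  The reduced values lie in \<open>[0, 1)\<close>, and
  therefore the digits agree; for \<open>j = n\<close> the remainder is 0.
\<close>

lemma greedy_rem_truncation:
  assumes c: "\<And>k. c k > 0" and "j \<le> n"
  defines "z \<equiv> 1 - quasi_rem c n / (\<Prod>i<n. c i)"
  shows "greedy_rem c z j = quasi_rem c j - quasi_rem c n / (\<Prod>i=j..<n. c i)"
    and "j < n \<Longrightarrow> \<lfloor>c j * greedy_rem c z j\<rfloor> = quasi_digit c j"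
proof -
  have pos: "(\<Prod>i=k..<n. c i) > 0" for k using c by (intro prod_pos) simp
  have dig: "\<lfloor>c k * (quasi_rem c k - quasi_rem c n / (\<Prod>i=k..<n. c i))\<rfloor> = quasi_digit c k \<and>
     frac (c k * (quasi_rem c k - quasi_rem c n / (\<Prod>i=k..<n. c i)))
       = quasi_rem c (Suc k) - quasi_rem c n / (\<Prod>i=Suc k..<n. c i)"
    if "k < n" for k
  proof -
    let ?r = "quasi_rem c (Suc k) - quasi_rem c n / (\<Prod>i=Suc k..<n. c i)"
    have "c k * (quasi_rem c k - quasi_rem c n / (\<Prod>i=k..<n. c i))
        = c k * quasi_rem c k - quasi_rem c n / (\<Prod>i=Suc k..<n. c i)"
      using c[of k] pos[of "Suc k"] by (simp add: prod_drop_first[OF that] right_diff_distrib)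
    then have eq: "c k * (quasi_rem c k - quasi_rem c n / (\<Prod>i=k..<n. c i))
        = of_int (quasi_digit c k) + ?r"
      by (simp only: quasi_rem_Suc)
    have "?r \<ge> 0"
      using quasi_rem_mult_ge[of c "Suc k" n] c that pos[of "Suc k"]
      by (simp add: divide_le_eq del: quasi_rem.simps)
    moreover have "quasi_rem c n / (\<Prod>i=Suc k..<n. c i) > 0"
      using quasi_rem_bounds[of c n] pos[of "Suc k"] by simp
    then have "?r < 1"
      using quasi_rem_bounds[of c "Suc k"] by linarith
    ultimately have fl: "\<lfloor>of_int (quasi_digit c k) + ?r\<rfloor> = quasi_digit c k"
      by (intro floor_unique) linarith+
    then show ?thesis unfolding eq frac_def by simp
  qed
  have *: "greedy_rem c z k = quasi_rem c k - quasi_rem c n / (\<Prod>i=k..<n. c i)" if "k \<le> n" for k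
    using that
  proof (induction k)
    case 0
    then show ?case by (simp add: z_def lessThan_atLeast0)
  next
    case (Suc k)
    then show ?case using dig[of k] by (simp del: quasi_rem.simps)
  qed
  show "greedy_rem c z j = quasi_rem c j - quasi_rem c n / (\<Prod>i=j..<n. c i)"
    using * assms(2) by blast
  show "\<lfloor>c j * greedy_rem c z j\<rfloor> = quasi_digit c j" if "j < n"
    using * dig that by simp
qed

text \<open>
  For \<open>j = 0\<close> this says that a number \<open>y < 1\<close> whose greedy expansion stops after \<open>n\<close> digits is at
  most the truncation of the quasi-greedy expansion of 1 to \<open>n\<close> digits.
\<close>

lemma greedy_rem_less_quasi_rem:
  assumes c: "\<And>k. c k > 0" and y: "0 \<le> y" "y < 1"
    and j: "j \<le> n" "greedy_rem c y n = 0" "greedy_rem c y j < quasi_rem c j"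
  shows "quasi_rem c n \<le> (quasi_rem c j - greedy_rem c y j) * (\<Prod>i=j..<n. c i)"
  using j(1,3)
proof (induction j rule: inc_induct)
  case base
  then show ?case using j(2) by simp
next
  case (step j)
  let ?P = "\<Prod>i=Suc j..<n. c i"
  define f where "f = \<lfloor>c j * greedy_rem c y j\<rfloor>"
  have P: "?P > 0" using c by (intro prod_pos) simp
  have r: "c j * greedy_rem c y j = of_int f + greedy_rem c y (Suc j)"
    by (simp add: frac_def f_def)
  have q: "c j * quasi_rem c j = of_int (quasi_digit c j) + quasi_rem c (Suc j)"
    by (rule quasi_rem_Suc)
  have lt: "c j * greedy_rem c y j < c j * quasi_rem c j"
    using c[of j] step by simp
  then have "f \<le> quasi_digit c j" unfolding f_def quasi_digit_def by linarith
  then consider "f = quasi_digit c j" | "f + 1 \<le> quasi_digit c j" by linarith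
  then have "quasi_rem c n \<le> (c j * quasi_rem c j - c j * greedy_rem c y j) * ?P"
  proof cases
    case 1
    then show ?thesis using step.IH lt unfolding q r by simp
  next
    case 2
    \<comment> \<open>A strictly smaller digit costs 1, which outweighs the greedy remainder that follows;
      the induction hypothesis is not needed.\<close>
    then have "(of_int f :: real) + 1 \<le> of_int (quasi_digit c j)" by linarith
    moreover have "greedy_rem c y (Suc j) < 1" using greedy_rem_bounds[OF y] by blast
    ultimately have "quasi_rem c (Suc j) \<le> c j * quasi_rem c j - c j * greedy_rem c y j"
      unfolding q r by linarith
    then have "quasi_rem c (Suc j) * ?P \<le> (c j * quasi_rem c j - c j * greedy_rem c y j) * ?P"
      using P by simp
    moreover have "quasi_rem c n \<le> quasi_rem c (Suc j) * ?P"
      using quasi_rem_mult_ge[of c "Suc j" n, OF c] step.hyps by (simp del: quasi_rem.simps)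
    ultimately show ?thesis by linarith
  qed
  then show ?case using step.hyps by (simp add: prod_drop_first algebra_simps)
qed

section \<open>Consequences of the divergence of the base product\<close>

lemma greedy_rem_no_digits:
  assumes c: "\<And>k. c k > 0" and y: "0 \<le> y" "y < 1"
    and lim: "filterlim (\<lambda>k. \<Prod>i<k. c i) at_top sequentially"
    and dig: "\<And>k. \<lfloor>c k * greedy_rem c y k\<rfloor> = 0"
  shows "y = 0"
proof -
  have eq: "greedy_rem c y k = y * (\<Prod>i<k. c i)" for k
  proof (induction k)
    case (Suc k)
    then show ?case using dig[of k] by (simp add: frac_def)
  qed simp
  show ?thesis
  proof (rule ccontr)
    assume "y \<noteq> 0"
    then have y0: "y > 0" using y by simp
    obtain k where "(\<Prod>i<k. c i) \<ge> 1 / y"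
      using lim unfolding filterlim_at_top eventually_sequentially by blast
    then have "greedy_rem c y k \<ge> 1" using y0 by (simp add: eq field_simps)
    then show False using greedy_rem_bounds[OF y, of c k] by linarith
  qed
qed

lemma quasi_rem_sums:
  assumes c: "\<And>k. c k > 0"
    and lim: "filterlim (\<lambda>k. \<Prod>i<k. c (n + i)) at_top sequentially"
  shows "(\<lambda>k. of_int (quasi_digit c (n + k)) / (\<Prod>i\<le>k. c (n + i))) sums quasi_rem c n"
proof -
  let ?P = "\<lambda>k. \<Prod>i<k. c (n + i)"
  have pos: "?P k > 0" for k using c by (intro prod_pos) simp
  have part: "(\<Sum>k<m. of_int (quasi_digit c (n + k)) / (\<Prod>i\<le>k. c (n + i)))
      = quasi_rem c n - quasi_rem c (n + m) / ?P m" for m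
  proof (induction m)
    case (Suc m)
    have "quasi_rem c (n + m) = (of_int (quasi_digit c (n + m)) + quasi_rem c (n + Suc m)) / c (n + m)"
      using quasi_rem_Suc[of c "n + m"] c[of "n + m"] by (simp add: field_simps del: quasi_rem.simps)
    then have "quasi_rem c (n + m) / ?P m
        = of_int (quasi_digit c (n + m)) / ?P (Suc m) + quasi_rem c (n + Suc m) / ?P (Suc m)"
      by (simp add: add_divide_distrib mult.commute del: quasi_rem.simps)
    moreover have "(\<Prod>i\<le>m. c (n + i)) = ?P (Suc m)" by (simp only: lessThan_Suc_atMost)
    ultimately show ?case using Suc by (simp del: quasi_rem.simps)
  qed simp
  have "(\<lambda>m. quasi_rem c (n + m) / ?P m) \<longlonglongrightarrow> 0"
  proof (rule tendsto_sandwich[of "\<lambda>_. 0" _ _ "\<lambda>m. 1 / ?P m"])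
    show "eventually (\<lambda>m. 0 \<le> quasi_rem c (n + m) / ?P m) sequentially"
      using quasi_rem_bounds pos by (simp add: less_imp_le)
    show "eventually (\<lambda>m. quasi_rem c (n + m) / ?P m \<le> 1 / ?P m) sequentially"
      using quasi_rem_bounds pos by (simp add: divide_right_mono less_imp_le)
    show "(\<lambda>m. 1 / ?P m) \<longlonglongrightarrow> 0"
      by (rule tendsto_divide_0[OF tendsto_const filterlim_at_top_imp_at_infinity[OF lim]])
  qed simp
  then have "(\<lambda>m. quasi_rem c n - quasi_rem c (n + m) / ?P m) \<longlonglongrightarrow> quasi_rem c n - 0"
    by (intro tendsto_intros)
  then show ?thesis unfolding sums_def part by simp
qed

section \<open>Expansions in a two-way base\<close>

text \<open>
  The one-sided base \<open>\<beta>\<^bsub>m-1\<^esub>, \<beta>\<^bsub>m-2\<^esub>, \<dots>\<close>, which governs the digits below position \<open>m\<close>.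
\<close>

definition down_base :: "base \<Rightarrow> int \<Rightarrow> nat \<Rightarrow> real" where
  "down_base B m j = B (m - 1 - int j)"

lemma base_weight_pos:
  assumes "\<And>n. B n > 1"
  shows "base_weight B n > 0"
  unfolding base_weight_def using assms by (intro prod_pos) (meson less_trans zero_less_one)

lemma base_weight_mono:
  assumes "\<And>n. B n > 1" "m \<le> n"
  shows "base_weight B m \<le> base_weight B n"
proof -
  have "1 \<le> B i" "0 \<le> B i" for i using assms(1)[of i] by simp_all
  then show ?thesis unfolding base_weight_def using assms(2) by (intro prod_mono2) auto
qed

lemma prod_down_base: "(\<Prod>i<n. down_base B (int n) i) = base_weight B n"
  unfolding base_weight_def down_base_def
  by (subst prod.nat_diff_reindex[symmetric]) (rule prod.cong, auto simp: of_nat_diff)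

lemma prod_down_base_0: "(\<Prod>i<k. down_base B 0 i) = (\<Prod>i=1..k. B (- int i))"
  unfolding One_nat_def prod.atLeast1_atMost_eq
  by (rule prod.cong) (auto simp: down_base_def intro!: arg_cong[of _ _ B])

lemma down_base_0_at_top:
  assumes "two_way_cantor_base B"
  shows "filterlim (\<lambda>k. \<Prod>i<k. down_base B 0 i) at_top sequentially"
  using assms by (simp add: two_way_cantor_base_def prod_down_base_0)

text \<open>
  Since the weight of position 0 is 1, both cases in the definition of \<^const>\<open>exp_start\<close> have one
  description: the leading position is \<open>s - 1\<close> for the least \<open>s\<close> whose weight exceeds \<open>x\<close>.
\<close>

lemma exp_start_bounds:
  assumes B: "two_way_cantor_base B"
  obtains s where "exp_start B x = int s - 1" "x < base_weight B s"
    "\<And>m. x < base_weight B m \<Longrightarrow> s \<le> m"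
proof (cases "x < 1")
  case True
  show ?thesis by (rule that[of 0]) (use True in \<open>simp_all add: exp_start_def base_weight_def\<close>)
next
  case False
  let ?Q = "\<lambda>N. x < (\<Prod>i\<le>N. B (int i))"
  have Q: "?Q N \<longleftrightarrow> x < base_weight B (Suc N)" for N
    by (simp add: base_weight_def lessThan_Suc_atMost)
  have "eventually (\<lambda>N. x < base_weight B N) sequentially"
    using B unfolding two_way_cantor_base_def base_weight_def filterlim_at_top_dense by blast
  then obtain K where "x < base_weight B (Suc K)"
    unfolding eventually_sequentially by (meson le_SucI le_refl)
  then have "?Q K" using Q by blast
  show ?thesis
  proof (rule that[of "Suc (LEAST N. ?Q N)"])
    show "exp_start B x = int (Suc (LEAST N. ?Q N)) - 1"
      using False by (simp add: exp_start_def)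
    show "x < base_weight B (Suc (LEAST N. ?Q N))"
      using LeastI[of ?Q, OF \<open>?Q K\<close>] Q by blast
    fix m assume m: "x < base_weight B m"
    with False obtain N where "m = Suc N" by (cases m) (auto simp: base_weight_def)
    with m show "Suc (LEAST N. ?Q N) \<le> m" using Least_le[of ?Q N] Q by simp
  qed
qed

lemma exp_rest_conv_greedy_rem:
  assumes s: "exp_start B x = int s - 1"
  shows "exp_rest B x k = greedy_rem (down_base B (int s)) (x / base_weight B s) k"
proof (induction k)
  case 0
  show ?case
  proof (cases "x < 1")
    case True
    then show ?thesis using s by (simp add: exp_start_def base_weight_def)
  next
    case False
    then have "s \<noteq> 0" using s by (auto simp: exp_start_def)
    then obtain N where "s = Suc N" by (cases s) auto
    then show ?thesis using False s by (simp add: base_weight_def lessThan_Suc_atMost)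
  qed
next
  case (Suc k)
  then show ?case using s by (simp add: frac_def down_base_def)
qed

text \<open>
  Starting the greedy algorithm \<open>p\<close> positions above \<open>s\<close> only changes the scale of the remainder:
  the extra \<open>p\<close> digits are leading zeros.
\<close>

lemma greedy_rem_leading_zeros:
  assumes B: "\<And>n. B n > 1" and x: "0 \<le> x" "x < base_weight B s"
  shows "k \<le> p \<Longrightarrow> greedy_rem (down_base B (int (s + p))) (x / base_weight B (s + p)) k
           = x / base_weight B (s + p - k)"
proof (induction k)
  case (Suc k)
  obtain l where l: "s + p - k = Suc l" "s \<le> l" using Suc.prems by (cases "s + p - k") auto
  have "down_base B (int (s + p)) k = B (int l)"
    using l Suc.prems by (auto simp: down_base_def intro!: arg_cong[of _ _ B])
  moreover have "base_weight B (Suc l) = base_weight B l * B (int l)"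
    by (simp add: base_weight_def)
  moreover have "B (int l) > 0" using B[of "int l"] by simp
  ultimately have eq: "down_base B (int (s + p)) k * (x / base_weight B (s + p - k))
      = x / base_weight B l"
    using l by simp
  have "x < base_weight B l" using x(2) base_weight_mono[of B s l, OF B l(2)] by simp
  then have "0 \<le> x / base_weight B l" "x / base_weight B l < 1"
    using x(1) base_weight_pos[of B l, OF B] by simp_all
  then have "frac (x / base_weight B l) = x / base_weight B l" by (simp add: frac_eq)
  moreover have "s + p - Suc k = l" using l by simp
  ultimately show ?case using Suc eq by simp
qed simp

text \<open>
  The \<open>B\<close>-expansion may be computed from any position \<open>m\<close> whose weight exceeds \<open>x\<close>, not only from
  the least one.
\<close>

lemma expansion_conv_greedy_rem:
  assumes B: "two_way_cantor_base B" and x: "0 \<le> x" "x < base_weight B m"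
  shows "expansion B x i = (if i \<ge> int m then 0
    else nat \<lfloor>B i * greedy_rem (down_base B (int m)) (x / base_weight B m) (nat (int m - 1 - i))\<rfloor>)"
proof -
  have B1: "\<And>n. B n > 1" using B by (simp add: two_way_cantor_base_def)
  obtain s where s: "exp_start B x = int s - 1" "x < base_weight B s" "s \<le> m"
    using exp_start_bounds[OF B, of x] x(2) by metis
  define p where "p = m - s"
  have m: "m = s + p" using s(3) by (simp add: p_def)
  note lead = greedy_rem_leading_zeros[of B x s _ p, OF B1 x(1) s(2), folded m]
  consider "i \<ge> int m" | "int s \<le> i" "i < int m" | "i < int s" by linarith
  then show ?thesis
  proof cases
    case 1
    then show ?thesis using s by (simp add: expansion_def)
  next
    case 2
    define l where "l = nat i"
    have i: "i = int l" "s \<le> l" "l < m" using 2 by (auto simp: l_def)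
    have k: "nat (int m - 1 - i) = m - Suc l" using i by simp
    have "greedy_rem (down_base B (int m)) (x / base_weight B m) (m - Suc l)
        = x / base_weight B (Suc l)"
      using lead[of "m - Suc l"] i m by (simp add: algebra_simps)
    then have "B i * greedy_rem (down_base B (int m)) (x / base_weight B m) (nat (int m - 1 - i))
        = B (int l) * (x / base_weight B (Suc l))"
      using k i by simp
    also have "\<dots> = x / base_weight B l"
      using B1[of "int l"] by (simp add: base_weight_def)
    finally have eq: "B i * greedy_rem (down_base B (int m)) (x / base_weight B m) (nat (int m - 1 - i))
        = x / base_weight B l" .
    have "x < base_weight B l" using s(2) base_weight_mono[of B s l, OF B1 i(2)] by simp
    then have "\<lfloor>x / base_weight B l\<rfloor> = 0"
      using x(1) base_weight_pos[of B l, OF B1] by (intro floor_unique) simp_all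
    then show ?thesis using eq s 2 by (simp add: expansion_def)
  next
    case 3
    define k where "k = nat (int s - 1 - i)"
    have k: "nat (int m - 1 - i) = p + k" using 3 m by (simp add: k_def)
    have "down_base B (int m) (p + j) = down_base B (int s) j" for j
      using m by (simp add: down_base_def algebra_simps)
    then have "greedy_rem (down_base B (int m)) (x / base_weight B m) (p + k)
        = greedy_rem (down_base B (int s)) (x / base_weight B s) k"
      using lead[of p] m by (simp add: greedy_rem_add)
    then show ?thesis
      using 3 s k exp_rest_conv_greedy_rem[OF s(1)] by (simp add: expansion_def k_def)
  qed
qed

lemma tendsto_fun_iff:
  "(f \<longlongrightarrow> l) F \<longleftrightarrow> (\<forall>i. ((\<lambda>x. f x i) \<longlongrightarrow> l i) F)"
  for l :: "'a \<Rightarrow> 'b :: topological_space"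
  using limitin_componentwise[of "\<lambda>_. euclidean" UNIV f l F]
  by (simp add: euclidean_product_topology)

lemma quasi_greedy_one_eq:
  assumes C: "\<And>i. C i > 0"
  shows "quasi_greedy_one C (Suc k) = nat (quasi_digit (down_base C 0) k)"
proof -
  let ?c = "down_base C 0"
  define l where "l = (\<lambda>i::int. if i \<ge> 0 then 0 else nat (quasi_digit ?c (nat (- 1 - i))))"
  have c: "\<And>k. ?c k > 0" using C by (simp add: down_base_def)
  have less: "eventually (\<lambda>y::real. y < 1) (at_left 1)" by (simp add: eventually_at_filter)
  have exp: "expansion C y i = (if i \<ge> 0 then 0
      else nat \<lfloor>?c (nat (- 1 - i)) * greedy_rem ?c y (nat (- 1 - i))\<rfloor>)" if "y < 1" for y i
  proof -
    have s: "exp_start C y = int 0 - 1" using that by (simp add: exp_start_def)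
    show ?thesis unfolding expansion_def exp_rest_conv_greedy_rem[OF s] using s
      by (simp add: base_weight_def down_base_def)
  qed
  have "((\<lambda>y. expansion C y i) \<longlongrightarrow> l i) (at_left 1)" for i
  proof (rule tendsto_eventually)
    show "eventually (\<lambda>y. expansion C y i = l i) (at_left 1)"
      using less greedy_digit_at_left_1[of ?c "nat (- 1 - i)", OF c]
      by eventually_elim (simp add: exp l_def)
  qed
  then have lim: "(expansion C \<longlongrightarrow> l) (at_left 1)" by (simp add: tendsto_fun_iff)
  have "(THE l. (expansion C \<longlongrightarrow> l) (at_left 1)) = l"
  proof (rule the_equality)
    fix l' assume "(expansion C \<longlongrightarrow> l') (at_left 1)"
    then have "l' i = l i" for i
      using tendsto_unique[OF trivial_limit_at_left_real] lim by (metis tendsto_fun_iff)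
    then show "l' = l" by blast
  qed (rule lim)
  then show ?thesis by (simp add: quasi_greedy_one_def l_def)
qed

lemma M_eq:
  fixes n :: nat
  assumes B: "two_way_cantor_base B"
  defines "c \<equiv> down_base B (int n)"
  shows "M B n = base_weight B n - quasi_rem c n"
    and "expansion B (M B n) i = (if 0 \<le> i \<and> i < int n
           then nat (quasi_digit c (nat (int n - 1 - i))) else 0)"
proof -
  let ?W = "base_weight B n"
  have B1: "\<And>n. B n > 1" using B by (simp add: two_way_cantor_base_def)
  have c: "\<And>k. c k > 0" using B1 by (simp add: c_def down_base_def less_trans[OF zero_less_one])
  have W: "?W > 0" "(\<Prod>i<n. c i) = ?W" "(\<Prod>i=0..<n. c i) = ?W"
    using base_weight_pos[of B n] B1 prod_down_base[of B n]
    by (simp_all add: c_def lessThan_atLeast0)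
  define z where "z = ?W - quasi_rem c n"
  have z: "0 \<le> z" "z < ?W"
    using quasi_rem_mult_ge[of c 0 n, OF c] quasi_rem_bounds[of c n] W by (simp_all add: z_def)
  have zW: "z / ?W = 1 - quasi_rem c n / (\<Prod>i<n. c i)"
    using W by (simp add: z_def diff_divide_distrib)
  have dig: "\<lfloor>c j * greedy_rem c (z / ?W) j\<rfloor> = quasi_digit c j" if "j < n" for j
    using greedy_rem_truncation(2)[of c j n, OF c] that unfolding zW by simp
  have "greedy_rem c (z / ?W) n = 0"
    using greedy_rem_truncation(1)[of c n n, OF c] unfolding zW by simp
  then have tail: "greedy_rem c (z / ?W) j = 0" if "j \<ge> n" for j
    using that greedy_rem_add[of c "z / ?W" n "j - n"] by (simp add: greedy_rem_zero)
  have ci: "B i = c (nat (int n - 1 - i))" if "i < int n" for i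
    using that by (simp add: c_def down_base_def)
  have exp: "expansion B x i = (if i \<ge> int n then 0
      else nat \<lfloor>c (nat (int n - 1 - i)) * greedy_rem c (x / ?W) (nat (int n - 1 - i))\<rfloor>)"
    if "0 \<le> x" "x < ?W" for x i
    using expansion_conv_greedy_rem[OF B that] ci by (simp add: c_def)
  have expz: "expansion B z i = (if 0 \<le> i \<and> i < int n
           then nat (quasi_digit c (nat (int n - 1 - i))) else 0)" for i
    unfolding exp[OF z] using dig tail by auto
  have M: "M B n = z" unfolding M_def
  proof (rule Greatest_equality)
    show "z \<in> B_integers B \<and> z < ?W" using z expz by (simp add: B_integers_def)
    fix x assume x: "x \<in> B_integers B \<and> x < ?W"
    then have x0: "0 \<le> x" "x < ?W" and dx: "\<And>i. i < 0 \<Longrightarrow> expansion B x i = 0"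
      by (auto simp: B_integers_def)
    have y: "0 \<le> x / ?W" "x / ?W < 1" using x0 W by simp_all
    \<comment> \<open>The digits of \<open>x\<close> after the radix point are those of this remainder in the base
      \<open>\<beta>\<^bsub>-1\<^esub>, \<beta>\<^bsub>-2\<^esub>, \<dots>\<close>.\<close>
    have "greedy_rem c (x / ?W) n = 0"
    proof (rule greedy_rem_no_digits[of "down_base B 0"])
      show "\<And>k. down_base B 0 k > 0" using B1 by (simp add: down_base_def less_trans[OF zero_less_one])
      show "0 \<le> greedy_rem c (x / ?W) n" "greedy_rem c (x / ?W) n < 1"
        using greedy_rem_bounds[OF y] by blast+
      show "filterlim (\<lambda>k. \<Prod>i<k. down_base B 0 i) at_top sequentially"
        by (rule down_base_0_at_top[OF B])
      fix k
      have sh: "c (n + j) = down_base B 0 j" for j by (simp add: c_def down_base_def algebra_simps)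
      have nn: "nat (int n - 1 - (- 1 - int k)) = n + k" by simp
      have "nat \<lfloor>c (n + k) * greedy_rem c (x / ?W) (n + k)\<rfloor> = 0"
        using dx[of "- 1 - int k"] exp[OF x0, of "- 1 - int k"] unfolding nn by simp
      moreover have "0 \<le> c (n + k) * greedy_rem c (x / ?W) (n + k)"
        using c[of "n + k"] greedy_rem_bounds[OF y, of c "n + k"] by simp
      ultimately have "\<lfloor>c (n + k) * greedy_rem c (x / ?W) (n + k)\<rfloor> = 0" by linarith
      then show "\<lfloor>down_base B 0 k * greedy_rem (down_base B 0) (greedy_rem c (x / ?W) n) k\<rfloor> = 0"
        by (simp add: greedy_rem_add sh)
    qed
    then have "quasi_rem c n \<le> (1 - x / ?W) * ?W"
      using greedy_rem_less_quasi_rem[of c "x / ?W" 0 n, OF c y] y W by simp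
    then show "x \<le> z" using W(1) by (simp add: z_def algebra_simps)
  qed
  show "M B n = base_weight B n - quasi_rem c n" using M z_def by simp
  show "expansion B (M B n) i = (if 0 \<le> i \<and> i < int n
           then nat (quasi_digit c (nat (int n - 1 - i))) else 0)" using M expz by simp
qed

theorem proposition16:
  fixes B :: "int \<Rightarrow> real" and n :: nat and d :: "nat \<Rightarrow> nat"
  assumes "two_way_cantor_base B"
  defines "d \<equiv> quasi_greedy_one (shift_base (int n) B)"
  shows "expansion B (M B n) = radix_word (map d [1..<Suc n]) (\<lambda>k. 0)
         \<and> has_val B (radix_word [0] (\<lambda>k. d (n + k)))
         \<and> Delta B n = val B (radix_word [0] (\<lambda>k. d (n + k)))"
proof -
  let ?a = "radix_word [0] (\<lambda>k. d (n + k))"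
  define c where "c = down_base B (int n)"
  have B1: "\<And>n. B n > 1" using assms(1) by (simp add: two_way_cantor_base_def)
  have c: "\<And>k. c k > 0" using B1 by (simp add: c_def down_base_def less_trans[OF zero_less_one])
  have "down_base (shift_base (int n) B) 0 = c"
    by (rule ext) (simp add: c_def down_base_def shift_base_def algebra_simps)
  then have d: "d (Suc k) = nat (quasi_digit c k)" for k
    unfolding d_def using B1
    by (subst quasi_greedy_one_eq) (simp_all add: shift_base_def less_trans[OF zero_less_one])
  have expM: "expansion B (M B n) = radix_word (map d [1..<Suc n]) (\<lambda>k. 0)"
  proof
    fix i
    show "expansion B (M B n) i = radix_word (map d [1..<Suc n]) (\<lambda>k. 0) i"
    proof (cases "0 \<le> i \<and> i < int n")
      case True
      then have "rev (map d [1..<Suc n]) ! nat i = d (Suc (nat (int n - 1 - i)))"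
        by (auto simp: rev_nth nat_diff_distrib simp del: upt_Suc intro!: arg_cong[of _ _ d])
      then show ?thesis using True
        by (simp add: M_eq(2)[OF assms(1)] radix_word_def d c_def nat_less_iff del: upt_Suc)
    next
      case False
      then show ?thesis by (auto simp: M_eq(2)[OF assms(1)] radix_word_def simp del: upt_Suc)
    qed
  qed
  have zero: "?a i = 0" if "i \<ge> 0" for i using that by (simp add: radix_word_def nth_Cons')
  have sh: "c (n + j) = down_base B 0 j" for j by (simp add: c_def down_base_def algebra_simps)
  have frac: "frac_term B ?a (Suc k) = of_int (quasi_digit c (n + k)) / (\<Prod>i\<le>k. c (n + i))" for k
  proof -
    have "?a (- int (Suc k)) = d (Suc (n + k))"
      by (simp add: radix_word_def del: of_nat_Suc)
    then show ?thesis
      using quasi_digit_nonneg[of c "n + k", OF c]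
      unfolding frac_term_def sh lessThan_Suc_atMost[symmetric] prod_down_base_0 by (simp add: d)
  qed
  have "filterlim (\<lambda>k. \<Prod>i<k. c (n + i)) at_top sequentially"
    using down_base_0_at_top[OF assms(1)] by (simp add: sh)
  then have "(\<lambda>k. frac_term B ?a (Suc k)) sums quasi_rem c n"
    using quasi_rem_sums[of c n, OF c] by (simp add: frac)
  then have "has_val B ?a" "val B ?a = quasi_rem c n"
    using zero by (auto simp: has_val_def val_def sums_iff intro!: exI[of _ 0])
  then show ?thesis
    using expM by (simp add: Delta_def M_eq(1)[OF assms(1)] c_def)
qed

end
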